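(* If the norm of a Banach space $X$ is uniformly micro-semitransitive and $Y$ is a one-complemented subspace of $X$, then the norm of $Y$ (inherited from $X$) is uniformly micro-semitransitive.
   Context: Banach spaces are over $\mathbb{K}=\mathbb{R}$ or $\mathbb{C}$. $S_X$ is the unit sphere of $X$, $\mathcal{L}(X)$ the space of bounded linear operators on $X$ with the operator norm, and $\mathrm{Id}$ the identity operator. The norm of $X$ is uniformly micro-semitransitive if there is a function $\beta:(0,2)\to(0,\infty)$ such that whenever $\varepsilon\in(0,2)$ and $x,y\in S_X$ satisfy $\|x-y\|<\beta(\varepsilon)$, there is $T\in\mathcal{L}(X)$ with $\|T\|=1$, $Tx=y$ and $\|T-\mathrm{Id}\|<\varepsilon$. A (closed) subspace $Y$ of $X$ is one-complemented if it is the range of a linear projection $P:X\to X$ with $\|P\|\le 1$. *)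

theory Defs
  imports "HOL-Analysis.Analysis"
begin

text \<open>
  The scalar field is any \<^class>\<open>real_normed_field\<close>. By the Gelfand--Mazur theorem such a
  field is isometrically isomorphic to the real or the complex numbers, so this is exactly the
  convention ``over \<open>\<real>\<close> or \<open>\<complex>\<close>''. The underlying real Banach space is the type, and the last
  axiom says that its real structure is the one obtained by restriction of scalars.
\<close>

locale banach_space_over = vector_space smul
  for smul :: "'k::real_normed_field \<Rightarrow> 'a::banach \<Rightarrow> 'a" +
  assumes norm_smul: "norm (smul c x) = norm c * norm x"
    and smul_of_real: "smul (of_real r) x = r *\<^sub>R x"

text \<open>
  Bounded linear operators on a subspace \<open>Y\<close> are functions on the ambient type of which only the
  restriction to \<open>Y\<close> matters; the whole space is the case \<open>Y = UNIV\<close>.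
\<close>

definition bounded_operator_on ::
    "('k \<Rightarrow> 'a \<Rightarrow> 'a) \<Rightarrow> 'a::real_normed_vector set \<Rightarrow> ('a \<Rightarrow> 'a) \<Rightarrow> bool" where
  "bounded_operator_on smul Y T \<longleftrightarrow>
     T ` Y \<subseteq> Y \<and>
     (\<forall>x\<in>Y. \<forall>y\<in>Y. T (x + y) = T x + T y) \<and>
     (\<forall>c. \<forall>x\<in>Y. T (smul c x) = smul c (T x)) \<and>
     (\<exists>K. \<forall>x\<in>Y. norm (T x) \<le> norm x * K)"

definition onorm_on :: "'a::real_normed_vector set \<Rightarrow> ('a \<Rightarrow> 'a) \<Rightarrow> real" where
  "onorm_on Y T = (SUP x\<in>Y. norm (T x) / norm x)"

lemma onorm_on_UNIV: "onorm_on UNIV T = onorm T"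
  by (simp add: onorm_on_def onorm_def)

definition uniformly_micro_semitransitive ::
    "('k \<Rightarrow> 'a \<Rightarrow> 'a) \<Rightarrow> 'a::real_normed_vector set \<Rightarrow> bool" where
  "uniformly_micro_semitransitive smul Y \<longleftrightarrow>
     (\<exists>\<beta> :: real \<Rightarrow> real.
        (\<forall>\<epsilon>\<in>{0<..<2}. \<beta> \<epsilon> > 0) \<and>
        (\<forall>\<epsilon>\<in>{0<..<2}. \<forall>x \<in> Y \<inter> sphere 0 1. \<forall>y \<in> Y \<inter> sphere 0 1.
           norm (x - y) < \<beta> \<epsilon> \<longrightarrow>
           (\<exists>T. bounded_operator_on smul Y T \<and> onorm_on Y T = 1 \<and> T x = y \<and>
                onorm_on Y (\<lambda>z. T z - z) < \<epsilon>)))"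

definition one_complemented ::
    "('k::real_normed_field \<Rightarrow> 'a \<Rightarrow> 'a) \<Rightarrow> 'a::banach set \<Rightarrow> bool" where
  "one_complemented smul Y \<longleftrightarrow>
     module.subspace smul Y \<and> closed Y \<and>
     (\<exists>P. bounded_operator_on smul UNIV P \<and> P \<circ> P = P \<and> onorm P \<le> 1 \<and> range P = Y)"

lemma banach_space_over_scaleR:
  "banach_space_over (scaleR :: real \<Rightarrow> 'a::banach \<Rightarrow> 'a)"
  by unfold_locales (auto simp: algebra_simps)

lemma banach_space_over_complex: "banach_space_over ((*) :: complex \<Rightarrow> complex \<Rightarrow> complex)"
  by unfold_locales (auto simp: algebra_simps norm_mult scaleR_conv_of_real)

lemma bounded_operator_on_UNIV_iff:
  assumes "banach_space_over smul"
  shows "bounded_operator_on smul UNIV T \<longleftrightarrow>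
           Vector_Spaces.linear smul smul T \<and> bounded_linear T"
proof -
  interpret banach_space_over smul by fact
  show ?thesis
  proof
    assume T: "bounded_operator_on smul UNIV T"
    have "Vector_Spaces.linear smul smul T"
      using T by unfold_locales (auto simp: bounded_operator_on_def)
    moreover have "bounded_linear T"
      using T by (auto simp: bounded_operator_on_def bounded_linear_def bounded_linear_axioms_def
          linear_iff simp flip: smul_of_real)
    ultimately show "Vector_Spaces.linear smul smul T \<and> bounded_linear T" ..
  next
    assume T: "Vector_Spaces.linear smul smul T \<and> bounded_linear T"
    then interpret L: Vector_Spaces.linear smul smul T by simp
    show "bounded_operator_on smul UNIV T"
      using T bounded_linear.bounded[of T] by (auto simp: bounded_operator_on_def L.add L.scale)
  qed
qed

end

theory Submission imports Defs begin

text \<open>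
  If \<open>T\<close> witnesses the property of \<open>X\<close> at \<open>x, y \<in> Y\<close> and \<open>P\<close> is a contractive projection onto
  \<open>Y\<close>, then the compression \<open>P \<circ> T\<close> is a witness on \<open>Y\<close>: it still maps \<open>x\<close> to \<open>P y = y\<close>, and on
  \<open>Y\<close> its difference from the identity is \<open>P \<circ> (T - Id)\<close>. The same modulus \<open>\<beta>\<close> works.
\<close>

text \<open>At the zero vector the ratio is \<open>0 / 0 = 0\<close>, so there the bound comes from
  \<open>0 \<le> C\<close>. Nonemptiness of \<open>Y\<close> makes the real supremum a least upper
  bound.\<close>

lemma onorm_on_le:
  assumes "Y \<noteq> {}" "0 \<le> C" "\<And>z. z \<in> Y \<Longrightarrow> norm (T z) \<le> C * norm z"
  shows "onorm_on Y T \<le> C"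
  unfolding onorm_on_def
proof (rule cSUP_least)
  fix z assume "z \<in> Y"
  then show "norm (T z) / norm z \<le> C"
    using assms(2,3) by (cases "norm z = 0") (auto simp: divide_le_eq)
qed fact

text \<open>The constant \<open>C\<close> serves to bound the ratios above, so that their real
  supremum dominates each of them.\<close>

lemma ratio_le_onorm_on:
  assumes "\<And>z. z \<in> Y \<Longrightarrow> norm (T z) \<le> C * norm z" "0 \<le> C" "x \<in> Y"
  shows "norm (T x) / norm x \<le> onorm_on Y T"
  unfolding onorm_on_def
proof (rule cSUP_upper)
  have "norm (T z) / norm z \<le> C" if "z \<in> Y" for z
    using assms(1)[OF that] assms(2) by (cases "norm z = 0") (auto simp: divide_le_eq)
  then show "bdd_above ((\<lambda>z. norm (T z) / norm z) ` Y)"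
    by (rule bdd_aboveI2)
qed fact

theorem mainTheorem8:
  fixes smul :: "'k::real_normed_field \<Rightarrow> 'a::banach \<Rightarrow> 'a"
    and Y :: "'a set"
  assumes "banach_space_over smul"
    and "uniformly_micro_semitransitive smul UNIV"
    and "one_complemented smul Y"
  shows "uniformly_micro_semitransitive smul Y"
proof -
  obtain P where P: "bounded_operator_on smul UNIV P" "P \<circ> P = P" "onorm P \<le> 1" "range P = Y"
    using assms(3) unfolding one_complemented_def by blast
  interpret P: bounded_linear P
    using P(1) bounded_operator_on_UNIV_iff[OF assms(1)] by blast
  have fixed: "P z = z" if "z \<in> Y" for z
    using that P(2,4) by (metis comp_apply rangeE)
  have contr: "norm (P z) \<le> norm z" for z
    using onorm[OF P.bounded_linear_axioms, of z] mult_right_mono[OF P(3), of "norm z"] by simp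
  obtain \<beta> where pos: "\<And>\<epsilon>. \<epsilon> \<in> {0<..<2} \<Longrightarrow> \<beta> \<epsilon> > (0::real)"
    and \<beta>: "\<And>\<epsilon> x y. \<lbrakk>\<epsilon> \<in> {0<..<2}; x \<in> sphere 0 1; y \<in> sphere 0 1; norm (x - y) < \<beta> \<epsilon>\<rbrakk> \<Longrightarrow>
      \<exists>T. bounded_operator_on smul UNIV T \<and> onorm_on UNIV T = 1 \<and> T x = y \<and>
          onorm_on UNIV (\<lambda>z. T z - z) < \<epsilon>"
    using assms(2) unfolding uniformly_micro_semitransitive_def Int_UNIV_left by blast
  have "\<exists>S. bounded_operator_on smul Y S \<and> onorm_on Y S = 1 \<and> S x = y \<and>
          onorm_on Y (\<lambda>z. S z - z) < \<epsilon>"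
    if \<epsilon>: "\<epsilon> \<in> {0<..<2}" and x: "x \<in> Y \<inter> sphere 0 1" and y: "y \<in> Y \<inter> sphere 0 1"
      and less: "norm (x - y) < \<beta> \<epsilon>" for \<epsilon> x y
  proof -
    obtain T where T: "bounded_operator_on smul UNIV T" "onorm T = 1" "T x = y"
      "onorm (\<lambda>z. T z - z) < \<epsilon>"
      using \<beta>[OF \<epsilon> _ _ less] x y unfolding onorm_on_UNIV by blast
    interpret T: bounded_linear T
      using T(1) bounded_operator_on_UNIV_iff[OF assms(1)] by blast
    have D: "bounded_linear (\<lambda>z. T z - z)"
      by (intro bounded_linear_sub T.bounded_linear_axioms bounded_linear_ident)
    \<comment> \<open>The factor \<open>1\<close> stays explicit to match the form
      \<open>C * norm z\<close> in both lemmas on \<open>onorm_on\<close>.\<close>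
    have le: "norm ((P \<circ> T) z) \<le> 1 * norm z" for z
      using contr[of "T z"] onorm[OF T.bounded_linear_axioms, of z] T(2) by simp
    have Sx: "(P \<circ> T) x = y"
      using T(3) y fixed by simp
    have "bounded_operator_on smul Y (P \<circ> T)"
      unfolding bounded_operator_on_def
    proof (intro conjI)
      \<comment> \<open>\<open>T\<close> itself may leave \<open>Y\<close>; composing with
        \<open>P\<close> brings the values back.\<close>
      show "(P \<circ> T) ` Y \<subseteq> Y"
        using P(4) by auto
      show "\<forall>c. \<forall>z\<in>Y. (P \<circ> T) (smul c z) = smul c ((P \<circ> T) z)"
        using P(1) T(1) by (simp add: bounded_operator_on_def)
      show "\<exists>K. \<forall>z\<in>Y. norm ((P \<circ> T) z) \<le> norm z * K"
        using le by (intro exI[of _ 1]) simp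
    qed (simp add: P.add T.add)
    moreover have "onorm_on Y (P \<circ> T) = 1"
    proof (rule antisym)
      show "onorm_on Y (P \<circ> T) \<le> 1"
        using x by (intro onorm_on_le le) auto
      \<comment> \<open>The value 1 is attained at \<open>x\<close>, since \<open>x\<close> and its
        image \<open>y\<close> are both unit vectors.\<close>
      show "1 \<le> onorm_on Y (P \<circ> T)"
        using ratio_le_onorm_on[of Y "P \<circ> T" 1 x, OF le] x y unfolding Sx by simp
    qed
    moreover have "onorm_on Y (\<lambda>z. (P \<circ> T) z - z) \<le> onorm (\<lambda>z. T z - z)"
    proof (rule onorm_on_le)
      fix z assume "z \<in> Y"
      \<comment> \<open>Here \<open>z\<close> is replaced by \<open>P z\<close>, which is legitimate
        only on \<open>Y\<close>; contractivity of \<open>P\<close> then gives the estimate.\<close>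
      then have "(P \<circ> T) z - z = P (T z - z)"
        by (simp add: P.diff fixed)
      then show "norm ((P \<circ> T) z - z) \<le> onorm (\<lambda>z. T z - z) * norm z"
        using contr[of "T z - z"] onorm[OF D, of z] by simp
    qed (use x onorm_pos_le[OF D] in auto)
    ultimately show ?thesis
      using Sx T(4) by - (intro exI[of _ "P \<circ> T"] conjI, assumption+, rule le_less_trans)
  qed
  then show ?thesis
    unfolding uniformly_micro_semitransitive_def using pos by blast
qed

end
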